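(* Let $f:\mathbb{E}\to\mathbb{R}$ be a convex quartic polynomial on a finite-dimensional real vector space $\mathbb{E}$, and let $f_4=\frac{1}{24}D^4f$ be the associated symmetric $4$-linear form. Then for any $x,y\in\mathbb{E}$ we have $$0\le f_4[x]^2[y]^2 .$$ This property implies the following relations, for all $x,y\in\mathbb{E}$: $$2f_4[x,y]\preceq f_4[x]^2+f_4[y]^2,$$ $$\left(f_4[x]^2[y]^2\right)^2\le f_4[x]^4\cdot f_4[y]^4,$$ $$\left(f_4[x]^3[y]\right)^2\le f_4[x]^4\cdot f_4[x]^2[y]^2 .$$
   Context: $\mathbb{E}$ is a finite-dimensional real vector space with dual $\mathbb{E}^*$ and pairing $\langle g,x\rangle$. $f$ is a polynomial of degree four, so $D^4f$ does not depend on the point, and $f_4=\frac{1}{24}D^4f$ is a symmetric $4$-linear form on $\mathbb{E}$. Notation: $f_4[x]^4=f_4[x,x,x,x]$, $f_4[x]^3[y]=f_4[x,x,x,y]$, $f_4[x]^2[y]^2=f_4[x,x,y,y]$. For $x,y\in\mathbb{E}$, $f_4[x,y]$ denotes the self-adjoint linear operator $\mathbb{E}\to\mathbb{E}^*$ defined by $\langle f_4[x,y]h,h\rangle=f_4[x,y,h,h]$ for all $h\in\mathbb{E}$, and $f_4[x]^2=f_4[x,x]$. For self-adjoint $A,C:\mathbb{E}\to\mathbb{E}^*$, $A\preceq C$ means $\langle Ah,h\rangle\le\langle Ch,h\rangle$ for all $h\in\mathbb{E}$. *)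

theory Defs
  imports "HOL-Analysis.Analysis"
begin

text \<open>Polynomials of degree at most \<open>d\<close> on a real vector space: the graded version of the
  library's \<open>real_polynomial_function\<close>, with no topology on the space.\<close>

inductive poly_deg_le :: "nat \<Rightarrow> ('a::real_vector \<Rightarrow> real) \<Rightarrow> bool" where
  const: "poly_deg_le 0 (\<lambda>x. c)"
| linear: "linear l \<Longrightarrow> poly_deg_le 1 l"
| add: "poly_deg_le d f \<Longrightarrow> poly_deg_le d g \<Longrightarrow> poly_deg_le d (\<lambda>x. f x + g x)"
| mult: "poly_deg_le d f \<Longrightarrow> poly_deg_le e g \<Longrightarrow> poly_deg_le (d + e) (\<lambda>x. f x * g x)"
| mono: "poly_deg_le d f \<Longrightarrow> d \<le> e \<Longrightarrow> poly_deg_le e f"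

definition polynomial_of_degree :: "nat \<Rightarrow> ('a::real_vector \<Rightarrow> real) \<Rightarrow> bool" where
  "polynomial_of_degree d f \<longleftrightarrow> poly_deg_le d f \<and> (\<forall>k<d. \<not> poly_deg_le k f)"

definition dir_deriv :: "'a::real_vector \<Rightarrow> ('a \<Rightarrow> real) \<Rightarrow> 'a \<Rightarrow> real" where
  "dir_deriv h f x = deriv (\<lambda>t. f (x + t *\<^sub>R h)) 0"

definition D4 :: "('a::real_vector \<Rightarrow> real) \<Rightarrow> 'a \<Rightarrow> 'a \<Rightarrow> 'a \<Rightarrow> 'a \<Rightarrow> 'a \<Rightarrow> real" where
  "D4 f z h1 h2 h3 h4 = dir_deriv h1 (dir_deriv h2 (dir_deriv h3 (dir_deriv h4 f))) z"

text \<open>The base point is irrelevant for quartics, see \<open>D4_const\<close> below; \<open>0\<close> is a choice.\<close>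

definition f4 :: "('a::real_vector \<Rightarrow> real) \<Rightarrow> 'a \<Rightarrow> 'a \<Rightarrow> 'a \<Rightarrow> 'a \<Rightarrow> real" where
  "f4 f h1 h2 h3 h4 = D4 f 0 h1 h2 h3 h4 / 24"

text \<open>Elements of the dual space are linear functionals \<open>'a \<Rightarrow> real\<close>, so the pairing of \<open>A h\<close>
  with \<open>k\<close> is \<open>A h k\<close>, for an operator \<open>A\<close> from the space to its dual.\<close>

definition self_adjoint :: "('a::real_vector \<Rightarrow> 'a \<Rightarrow> real) \<Rightarrow> bool" where
  "self_adjoint A \<longleftrightarrow>
     (\<forall>h. linear (A h)) \<and> (\<forall>k. linear (\<lambda>h. A h k)) \<and> (\<forall>h k. A h k = A k h)"

text \<open>That this is the self-adjoint operator with quadratic form \<open>\<lambda>h. f4 f x y h h\<close> is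
  \<open>f4_op_unique\<close> below.\<close>

definition f4_op :: "('a::real_vector \<Rightarrow> real) \<Rightarrow> 'a \<Rightarrow> 'a \<Rightarrow> 'a \<Rightarrow> 'a \<Rightarrow> real" where
  "f4_op f x y = (\<lambda>h k. f4 f x y h k)"

definition psd_le :: "('a::real_vector \<Rightarrow> 'a \<Rightarrow> real) \<Rightarrow> ('a \<Rightarrow> 'a \<Rightarrow> real) \<Rightarrow> bool"
    (infix \<open>\<preceq>\<close> 50) where
  "A \<preceq> C \<longleftrightarrow> (\<forall>h. A h h \<le> C h h)"

lemma poly_line_differentiable:
  assumes "poly_deg_le d f"
  shows "(\<lambda>t. f (x + t *\<^sub>R h)) field_differentiable at s"
  using assms
proof (induction rule: poly_deg_le.induct)
  case (linear l)
  have "(\<lambda>t. l (x + t *\<^sub>R h)) = (\<lambda>t. l x + t * l h)"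
    using linear by (simp add: linear_add linear_scale)
  then show ?case
    by (auto intro!: derivative_intros)
qed (auto intro!: derivative_intros)

lemma dir_deriv_const [simp]: "dir_deriv h (\<lambda>x. c) = (\<lambda>x. 0)"
  by (simp add: dir_deriv_def fun_eq_iff)

lemma dir_deriv_linear:
  assumes "linear l"
  shows "dir_deriv h l = (\<lambda>x. l h)"
proof
  fix x
  have "(\<lambda>t. l (x + t *\<^sub>R h)) = (\<lambda>t. l x + t * l h)"
    using assms by (simp add: linear_add linear_scale)
  moreover have "((\<lambda>t. l x + t * l h) has_field_derivative l h) (at 0)"
    by (auto intro!: derivative_eq_intros)
  ultimately show "dir_deriv h l x = l h"
    by (simp add: dir_deriv_def DERIV_imp_deriv)
qed

lemma dir_deriv_add:
  assumes "poly_deg_le d f" "poly_deg_le e g"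
  shows "dir_deriv h (\<lambda>x. f x + g x) = (\<lambda>x. dir_deriv h f x + dir_deriv h g x)"
  using poly_line_differentiable[OF assms(1)] poly_line_differentiable[OF assms(2)]
  by (simp add: dir_deriv_def fun_eq_iff deriv_add)

lemma dir_deriv_mult:
  assumes "poly_deg_le d f" "poly_deg_le e g"
  shows "dir_deriv h (\<lambda>x. f x * g x) = (\<lambda>x. f x * dir_deriv h g x + dir_deriv h f x * g x)"
  using poly_line_differentiable[OF assms(1)] poly_line_differentiable[OF assms(2)]
  by (simp add: dir_deriv_def fun_eq_iff deriv_mult)

lemma poly_deg_le_dir_deriv_aux:
  assumes "poly_deg_le d f"
  shows "poly_deg_le (d - 1) (dir_deriv h f) \<and> (d = 0 \<longrightarrow> dir_deriv h f = (\<lambda>x. 0))"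
  using assms
proof (induction rule: poly_deg_le.induct)
  case (const c)
  then show ?case by (simp add: poly_deg_le.const)
next
  case (linear l)
  then show ?case by (simp add: dir_deriv_linear poly_deg_le.const)
next
  case (add d f g)
  then show ?case by (auto simp: dir_deriv_add intro: poly_deg_le.add)
next
  case (mult d f e g)
  have 1: "poly_deg_le (d + e - 1) (\<lambda>x. f x * dir_deriv h g x)"
  proof (cases "e = 0")
    case True
    then show ?thesis
      using mult poly_deg_le.mono[OF poly_deg_le.const[of 0]] by auto
  next
    case False
    then show ?thesis
      using poly_deg_le.mult[of d f "e - 1" "dir_deriv h g"] mult by auto
  qed
  have 2: "poly_deg_le (d + e - 1) (\<lambda>x. dir_deriv h f x * g x)"
  proof (cases "d = 0")
    case True
    then show ?thesis
      using mult poly_deg_le.mono[OF poly_deg_le.const[of 0]] by auto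
  next
    case False
    then show ?thesis
      using poly_deg_le.mult[of "d - 1" "dir_deriv h f" e g] mult by auto
  qed
  show ?case
    using poly_deg_le.add[OF 1 2] mult by (auto simp: dir_deriv_mult)
next
  case (mono d f e)
  then show ?case by (auto intro: poly_deg_le.mono)
qed

lemma poly_deg_le_dir_deriv: "poly_deg_le d f \<Longrightarrow> poly_deg_le (d - 1) (dir_deriv h f)"
  using poly_deg_le_dir_deriv_aux by blast

lemma poly_deg_le_0:
  assumes "poly_deg_le d f" "d = 0"
  shows "f x = f y"
  using assms
proof (induction rule: poly_deg_le.induct)
  case (mult d f e g)
  then have "f x = f y" "g x = g y" by simp_all
  then show ?case by simp
qed auto

lemma D4_const:
  assumes "poly_deg_le 4 f"
  shows "D4 f z h1 h2 h3 h4 = D4 f z' h1 h2 h3 h4"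
proof -
  have "poly_deg_le (4 - 1 - 1 - 1 - 1) (dir_deriv h1 (dir_deriv h2 (dir_deriv h3 (dir_deriv h4 f))))"
    by (intro poly_deg_le_dir_deriv assms)
  then show ?thesis
    unfolding D4_def by (intro poly_deg_le_0[of 0]) auto
qed

lemma dir_deriv_commute:
  assumes "poly_deg_le d f"
  shows "dir_deriv h (dir_deriv k f) = dir_deriv k (dir_deriv h f)"
  using assms
proof (induction rule: poly_deg_le.induct)
  case (linear l)
  then show ?case by (simp add: dir_deriv_linear)
next
  case (add d f g)
  show ?case
    unfolding dir_deriv_add[OF add(1,2)]
      dir_deriv_add[OF poly_deg_le_dir_deriv[OF add(1)] poly_deg_le_dir_deriv[OF add(2)]]
    using add by simp
next
  case (mult d f e g)
  note D = poly_deg_le_dir_deriv[OF mult(1)] poly_deg_le_dir_deriv[OF mult(2)]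
  have "dir_deriv h (dir_deriv k (\<lambda>x. f x * g x)) =
      (\<lambda>x. f x * dir_deriv h (dir_deriv k g) x + dir_deriv h f x * dir_deriv k g x
         + (dir_deriv k f x * dir_deriv h g x + dir_deriv h (dir_deriv k f) x * g x))" for h k
    unfolding dir_deriv_mult[OF mult(1,2)]
    by (subst dir_deriv_add[OF poly_deg_le.mult[OF mult(1) D(2)] poly_deg_le.mult[OF D(1) mult(2)]])
      (simp add: dir_deriv_mult[OF mult(1) D(2)] dir_deriv_mult[OF D(1) mult(2)])
  then show ?case
    using mult by (simp add: fun_eq_iff)
qed auto

lemma linear_dir_deriv:
  assumes "poly_deg_le d f"
  shows "linear (\<lambda>h. dir_deriv h f x)"
  using assms
proof (induction rule: poly_deg_le.induct)
  case (const c)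
  then show ?case by (simp add: linear_zero)
next
  case (linear l)
  then show ?case by (simp add: dir_deriv_linear)
next
  case (add d f g)
  then show ?case by (simp add: dir_deriv_add linear_compose_add)
next
  case (mult d f e g)
  then show ?case
    by (auto simp: dir_deriv_mult linear_iff algebra_simps)
qed auto

lemma f4_symmetric:
  assumes "poly_deg_le 4 f"
  shows "f4 f a b c d = f4 f b a c d" "f4 f a b c d = f4 f a c b d" "f4 f a b c d = f4 f a b d c"
  using dir_deriv_commute[OF poly_deg_le_dir_deriv[OF poly_deg_le_dir_deriv[OF assms]]]
    dir_deriv_commute[OF poly_deg_le_dir_deriv[OF assms]] dir_deriv_commute[OF assms]
  by (simp_all add: f4_def D4_def)

lemma f4_linear:
  assumes "poly_deg_le 4 f"
  shows "linear (\<lambda>a. f4 f a b c d)" "linear (\<lambda>b. f4 f a b c d)"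
    "linear (\<lambda>c. f4 f a b c d)" "linear (\<lambda>d. f4 f a b c d)"
proof -
  have 1: "linear (\<lambda>a. f4 f a b c d)" for b c d
    using linear_dir_deriv[OF poly_deg_le_dir_deriv[OF poly_deg_le_dir_deriv
        [OF poly_deg_le_dir_deriv[OF assms]]], of b c d 0]
    by (simp add: f4_def D4_def linear_iff add_divide_distrib)
  note s = f4_symmetric[OF assms]
  show "linear (\<lambda>a. f4 f a b c d)" by (rule 1)
  have 2: "linear (\<lambda>b. f4 f a b c d)" for a c d using 1[of a c d] by (subst s(1))
  show "linear (\<lambda>b. f4 f a b c d)" by (rule 2)
  have 3: "linear (\<lambda>c. f4 f a b c d)" for a b d using 2[of a b d] by (subst s(2))
  show "linear (\<lambda>c. f4 f a b c d)" by (rule 3)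
  show "linear (\<lambda>d. f4 f a b c d)" using 3[of a b c] by (subst s(3))
qed

lemma self_adjoint_unique:
  assumes "self_adjoint A" "self_adjoint C" "\<And>h. A h h = C h h"
  shows "A = C"
proof (intro ext)
  fix h k
  have "A (h + k) (h + k) = A h h + 2 * A h k + A k k" if "self_adjoint A" for A :: "'a \<Rightarrow> 'a \<Rightarrow> real"
    using that unfolding self_adjoint_def linear_iff by (auto simp: algebra_simps)
  from this[OF assms(1)] this[OF assms(2)] show "A h k = C h k"
    using assms(3) by simp
qed

lemma f4_op_unique:
  assumes "poly_deg_le 4 f"
  shows "self_adjoint A \<and> (\<forall>h. A h h = f4 f x y h h) \<longleftrightarrow> A = f4_op f x y"
proof -
  have "self_adjoint (f4_op f x y)"
    unfolding self_adjoint_def f4_op_def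
    using f4_linear(3,4)[OF assms] f4_symmetric(3)[OF assms] by blast
  then show ?thesis
    using self_adjoint_unique[of A "f4_op f x y"] by (auto simp: f4_op_def)
qed

end

theory Submission
  imports Defs
begin

text \<open>Along a line a convex \<open>f\<close> has a nonnegative second derivative, so for fixed \<open>y\<close> the function
  \<open>g = D\<^sup>2f(\<cdot>)[y]\<^sup>2\<close> is nonnegative on the whole space. Since \<open>f\<close> is quartic, \<open>g\<close> restricted to the
  line \<open>t \<mapsto> t x\<close> is a parabola with leading coefficient \<open>12 f\<^sub>4[x]\<^sup>2[y]\<^sup>2\<close>, and a parabola that is
  bounded below cannot open downwards. This is \<open>f4_xxyy_nonneg\<close>.

  Everything else is algebra of a symmetric 4-linear form with that property. The operator
  inequality is the expansion of \<open>0 \<le> f\<^sub>4[x - y]\<^sup>2[h]\<^sup>2\<close>. The bound on \<open>f\<^sub>4[x]\<^sup>3[y]\<close> is the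
  Cauchy-Schwarz inequality for the positive semidefinite form \<open>f\<^sub>4[x]\<^sup>2\<close>, applied to \<open>x\<close> and \<open>y\<close>. For the bound
  on \<open>f\<^sub>4[x]\<^sup>2[y]\<^sup>2\<close> both pairs of arguments vary: the cross terms of
  \<open>(x + t y)(x - t y) = x\<^sup>2 - t\<^sup>2 y\<^sup>2\<close> cancel, and
  \<open>0 \<le> f\<^sub>4[x + t y]\<^sup>2[x - t y]\<^sup>2 = f\<^sub>4[x]\<^sup>4 - 2 t\<^sup>2 f\<^sub>4[x]\<^sup>2[y]\<^sup>2 + t\<^sup>4 f\<^sub>4[y]\<^sup>4\<close>
  is a quadratic inequality in \<open>t\<^sup>2\<close>, whose discriminant gives the claim.\<close>

lemma poly_deg_le_DERIV_line:
  assumes "poly_deg_le d f"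
  shows "((\<lambda>t. f (x + t *\<^sub>R h)) has_real_derivative dir_deriv h f (x + s *\<^sub>R h)) (at s)"
proof -
  have "((\<lambda>t. f ((x + s *\<^sub>R h) + t *\<^sub>R h)) has_real_derivative dir_deriv h f (x + s *\<^sub>R h)) (at 0)"
    unfolding dir_deriv_def
    by (rule DERIV_deriv_iff_field_differentiable[THEN iffD2, OF poly_line_differentiable[OF assms]])
  then have "((\<lambda>t. f (x + (t + s) *\<^sub>R h)) has_real_derivative dir_deriv h f (x + s *\<^sub>R h)) (at 0)"
    by (simp add: algebra_simps)
  then show ?thesis
    using DERIV_shift[of "\<lambda>t. f (x + t *\<^sub>R h)" "dir_deriv h f (x + s *\<^sub>R h)" 0 s] by simp
qed

lemma convex_on_imp_snd_dir_deriv_nonneg: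
  assumes f: "poly_deg_le d f" and conv: "convex_on UNIV f"
  shows "0 \<le> dir_deriv h (dir_deriv h f) z"
proof -
  define \<phi> where "\<phi> t = f (z + t *\<^sub>R h)" for t
  define \<phi>' where "\<phi>' t = dir_deriv h f (z + t *\<^sub>R h)" for t
  have d: "(\<phi> has_real_derivative \<phi>' t) (at t)" for t
    unfolding \<phi>_def \<phi>'_def by (rule poly_deg_le_DERIV_line[OF f])
  have d': "(\<phi>' has_real_derivative dir_deriv h (dir_deriv h f) (z + t *\<^sub>R h)) (at t)" for t
    unfolding \<phi>'_def by (rule poly_deg_le_DERIV_line[OF poly_deg_le_dir_deriv[OF f]])
  have "convex_on UNIV \<phi>"
  proof (rule convex_onI)
    fix t x y :: real assume "0 < t" "t < 1"
    have "z + ((1 - t) *\<^sub>R x + t *\<^sub>R y) *\<^sub>R h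
        = (1 - t) *\<^sub>R (z + x *\<^sub>R h) + t *\<^sub>R (z + y *\<^sub>R h)"
      by (simp add: algebra_simps)
    then show "\<phi> ((1 - t) *\<^sub>R x + t *\<^sub>R y) \<le> (1 - t) * \<phi> x + t * \<phi> y"
      using convex_onD[OF conv, of t "z + x *\<^sub>R h" "z + y *\<^sub>R h"] \<open>0 < t\<close> \<open>t < 1\<close>
      by (simp add: \<phi>_def)
  qed simp
  then have tangent: "\<phi> s - \<phi> t \<ge> \<phi>' t * (s - t)" for s t
    by (rule convex_on_imp_above_tangent[where A = UNIV]) (use d in auto)
  have "mono_on UNIV \<phi>'"
  proof (rule mono_onI)
    fix s t :: real assume "s \<le> t"
    \<comment> \<open>add the tangent inequalities at \<open>s\<close> and at \<open>t\<close>\<close>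
    have "0 \<le> (\<phi>' t - \<phi>' s) * (t - s)"
      using tangent[of s t] tangent[of t s] by (simp add: algebra_simps)
    then show "\<phi>' s \<le> \<phi>' t"
      using \<open>s \<le> t\<close> by (cases "s = t") (auto simp: zero_le_mult_iff)
  qed
  then have "0 \<le> dir_deriv h (dir_deriv h f) (z + 0 *\<^sub>R h)"
    by (rule mono_on_imp_deriv_nonneg[OF _ d']) simp
  then show ?thesis by simp
qed

lemma nonneg_quadratic_poly_snd_dir_deriv_nonneg:
  assumes g: "poly_deg_le 2 g" and nonneg: "\<And>z. 0 \<le> g z"
  shows "0 \<le> dir_deriv h (dir_deriv h g) z"
proof -
  define c where "c = dir_deriv h (dir_deriv h g) z"
  have deg: "poly_deg_le (2 - n) ((dir_deriv h ^^ n) g)" for n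
    by (induction n) (use g poly_deg_le_dir_deriv in \<open>fastforce simp: Suc_diff_Suc\<close>)+
  have c: "dir_deriv h (dir_deriv h g) w = c" for w
    using poly_deg_le_0[OF deg[of 2], of w z] by (simp add: c_def numeral_2_eq_2)
  have taylor: "g (z + t *\<^sub>R h) = g z + dir_deriv h g z * t + c / 2 * t\<^sup>2" for t
  proof -
    have "\<exists>s. \<bar>s\<bar> \<le> \<bar>t\<bar> \<and> g (z + t *\<^sub>R h) =
        (\<Sum>m<2. (dir_deriv h ^^ m) g (z + 0 *\<^sub>R h) / fact m * t ^ m)
        + (dir_deriv h ^^ 2) g (z + s *\<^sub>R h) / fact 2 * t ^ 2"
      by (rule Maclaurin_all_le[where diff = "\<lambda>m t. (dir_deriv h ^^ m) g (z + t *\<^sub>R h)"])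
        (use poly_deg_le_DERIV_line[OF deg] in auto)
    then show ?thesis by (auto simp: c numeral_2_eq_2)
  qed
  \<comment> \<open>adding the expansions at \<open>t\<close> and \<open>- t\<close> removes the linear term\<close>
  have bound: "0 \<le> 2 * g z + c * t\<^sup>2" for t
    using nonneg[of "z + t *\<^sub>R h"] nonneg[of "z + (- t) *\<^sub>R h"] unfolding taylor by simp
  show ?thesis
  proof (rule ccontr)
    assume "\<not> ?thesis"
    then have "c < 0" by (simp add: c_def)
    \<comment> \<open>chosen so that the right-hand side of \<open>bound\<close> equals \<open>- 1\<close>\<close>
    define t where "t = sqrt ((2 * g z + 1) / (- c))"
    have "t\<^sup>2 = (2 * g z + 1) / (- c)"
      unfolding t_def using \<open>c < 0\<close> nonneg[of z] by (intro real_sqrt_pow2 divide_nonneg_pos) auto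
    then have "c * t\<^sup>2 = - (2 * g z + 1)" using \<open>c < 0\<close> by simp
    then show False using bound[of t] by simp
  qed
qed

lemma f4_xxyy_nonneg:
  assumes f: "poly_deg_le 4 f" and conv: "convex_on UNIV f"
  shows "0 \<le> f4 f x x y y"
proof -
  have "poly_deg_le (4 - 1 - 1) (dir_deriv y (dir_deriv y f))"
    by (intro poly_deg_le_dir_deriv f)
  then have "poly_deg_le 2 (dir_deriv y (dir_deriv y f))" by simp
  then have "0 \<le> dir_deriv x (dir_deriv x (dir_deriv y (dir_deriv y f))) 0"
    by (rule nonneg_quadratic_poly_snd_dir_deriv_nonneg)
      (rule convex_on_imp_snd_dir_deriv_nonneg[OF f conv])
  then show ?thesis by (simp add: f4_def D4_def)
qed

lemma discriminant_of_nonneg_quadratic: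
  fixes a b c :: real
  assumes nonneg: "\<And>t. 0 \<le> a - 2 * b * t + c * t\<^sup>2" and "0 \<le> c"
  shows "b\<^sup>2 \<le> a * c"
proof (cases "c = 0")
  case True
  have "b = 0"
  proof (rule ccontr)
    assume "b \<noteq> 0"
    then show False using nonneg[of "(a + 1) / (2 * b)"] True by simp
  qed
  then show ?thesis using True by simp
next
  case False
  then show ?thesis
    using nonneg[of "b / c"] \<open>0 \<le> c\<close> by (simp add: field_simps power2_eq_square)
qed

lemma f4_add:
  assumes "poly_deg_le 4 f"
  shows "f4 f (x + y) b c d = f4 f x b c d + f4 f y b c d"
    "f4 f a (x + y) c d = f4 f a x c d + f4 f a y c d"
    "f4 f a b (x + y) d = f4 f a b x d + f4 f a b y d"
    "f4 f a b c (x + y) = f4 f a b c x + f4 f a b c y"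
  using f4_linear[OF assms] by (simp_all add: linear_iff)

lemma f4_scale:
  assumes "poly_deg_le 4 f"
  shows "f4 f (t *\<^sub>R x) b c d = t * f4 f x b c d"
    "f4 f a (t *\<^sub>R x) c d = t * f4 f a x c d"
    "f4 f a b (t *\<^sub>R x) d = t * f4 f a b x d"
    "f4 f a b c (t *\<^sub>R x) = t * f4 f a b c x"
  using f4_linear[OF assms] by (simp_all add: linear_iff)

lemma f4_square_of_combination:
  assumes "poly_deg_le 4 f"
  shows "f4 f (x + t *\<^sub>R y) (x + t *\<^sub>R y) c d = f4 f x x c d + 2 * t * f4 f x y c d + t\<^sup>2 * f4 f y y c d"
    and "f4 f a b (x + t *\<^sub>R y) (x + t *\<^sub>R y) = f4 f a b x x + 2 * t * f4 f a b x y + t\<^sup>2 * f4 f a b y y"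
  using f4_symmetric(1)[OF assms, of y x c d] f4_symmetric(3)[OF assms, of a b y x]
  by (simp_all add: f4_add[OF assms] f4_scale[OF assms] algebra_simps power2_eq_square)

lemma f4_op_psd_le:
  assumes f: "poly_deg_le 4 f" and conv: "convex_on UNIV f"
  shows "(\<lambda>h k. 2 * f4_op f x y h k) \<preceq> (\<lambda>h k. f4_op f x x h k + f4_op f y y h k)"
  unfolding psd_le_def f4_op_def
proof
  fix h
  show "2 * f4 f x y h h \<le> f4 f x x h h + f4 f y y h h"
    using f4_xxyy_nonneg[OF f conv, of "x + (- 1) *\<^sub>R y" h]
    unfolding f4_square_of_combination(1)[OF f] by simp
qed

text \<open>The difference-of-squares trick gives the quadratic inequality only at arguments \<open>s = t\<^sup>2\<close>;
  at negative \<open>s\<close> all its terms are nonnegative because \<open>f\<^sub>4[x]\<^sup>2[y]\<^sup>2\<close> is.\<close>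

lemma f4_xxyy_square_le:
  assumes f: "poly_deg_le 4 f" and conv: "convex_on UNIV f"
  shows "(f4 f x x y y)\<^sup>2 \<le> f4 f x x x x * f4 f y y y y"
proof (rule discriminant_of_nonneg_quadratic)
  note nonneg = f4_xxyy_nonneg[OF f conv]
  fix s :: real
  show "0 \<le> f4 f x x x x - 2 * f4 f x x y y * s + f4 f y y y y * s\<^sup>2"
  proof (cases "0 \<le> s")
    case True
    define t where "t = sqrt s"
    have s: "s = t\<^sup>2" using True by (simp add: t_def)
    have sym: "f4 f x y x x = f4 f x x x y" "f4 f y y x x = f4 f x x y y"
      "f4 f x y x y = f4 f x x y y" "f4 f y y x y = f4 f x y y y"
      by (metis f4_symmetric[OF f])+
    have "0 \<le> f4 f (x + t *\<^sub>R y) (x + t *\<^sub>R y) (x + (- t) *\<^sub>R y) (x + (- t) *\<^sub>R y)"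
      by (rule nonneg)
    also have "\<dots> = f4 f x x x x - 2 * f4 f x x y y * s + f4 f y y y y * s\<^sup>2"
      unfolding f4_square_of_combination[OF f] sym s by (simp add: algebra_simps power2_eq_square)
    finally show ?thesis .
  next
    case False
    then have "f4 f x x y y * s \<le> 0" "0 \<le> f4 f y y y y * s\<^sup>2"
      using nonneg by (simp_all add: mult_nonneg_nonpos)
    then show ?thesis using nonneg[of x x] by linarith
  qed
next
  show "0 \<le> f4 f y y y y" by (rule f4_xxyy_nonneg[OF f conv])
qed

lemma f4_xxxy_square_le:
  assumes f: "poly_deg_le 4 f" and conv: "convex_on UNIV f"
  shows "(f4 f x x x y)\<^sup>2 \<le> f4 f x x x x * f4 f x x y y"
proof (rule discriminant_of_nonneg_quadratic)
  fix t :: real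
  show "0 \<le> f4 f x x x x - 2 * f4 f x x x y * t + f4 f x x y y * t\<^sup>2"
    using f4_xxyy_nonneg[OF f conv, of x "x + (- t) *\<^sub>R y"]
    unfolding f4_square_of_combination(2)[OF f] by (simp add: algebra_simps)
next
  show "0 \<le> f4 f x x y y" by (rule f4_xxyy_nonneg[OF f conv])
qed

theorem theorem1:
  fixes f :: "'a::real_vector \<Rightarrow> real" and B :: "'a set"
  assumes "finite_dimensional_vector_space ((*\<^sub>R) :: real \<Rightarrow> 'a \<Rightarrow> 'a) B"
    and "polynomial_of_degree 4 f"
    and "convex_on UNIV f"
  shows "(\<forall>x y. 0 \<le> f4 f x x y y) \<and>
    (\<forall>x y. (\<lambda>h k. 2 * f4_op f x y h k) \<preceq> (\<lambda>h k. f4_op f x x h k + f4_op f y y h k)) \<and>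
    (\<forall>x y. (f4 f x x y y)\<^sup>2 \<le> f4 f x x x x * f4 f y y y y) \<and>
    (\<forall>x y. (f4 f x x x y)\<^sup>2 \<le> f4 f x x x x * f4 f x x y y)"
proof -
  have f: "poly_deg_le 4 f"
    using assms(2) by (simp add: polynomial_of_degree_def)
  show ?thesis
    using f4_xxyy_nonneg[OF f assms(3)] f4_op_psd_le[OF f assms(3)]
      f4_xxyy_square_le[OF f assms(3)] f4_xxxy_square_le[OF f assms(3)] by blast
qed

end
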